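(* Let $X$ be a compact topological space equipped with a Radon probability measure $\nu$, and let $\phi:X\to\mathbb{R}$ be a continuous function that is not $\nu$-almost everywhere constant. Let $\bar t=\int_X\phi\,d\nu$ be the mean, $\sigma>0$ the standard deviation, and $\kappa$ the skewness of $\phi$. Then the $4$-average $A_4^X(\phi)$, which is the unique real solution $x$ of $\int_X(\phi(y)-x)^3\,d\nu(y)=0$, is given by $$A_4^X(\phi)=\frac{\sigma}{\sqrt[3]{2}}\left(\sqrt[3]{\kappa+\sqrt{\kappa^2+4}}+\sqrt[3]{\kappa-\sqrt{\kappa^2+4}}\right)+\bar t,$$ where the cube roots are real cube roots.
   Context: The $4$-average $A_4^X(\phi)$ is the unique real number $\lambda$ minimizing $\lambda\mapsto\|\phi-\lambda\|_{L^4(X,\nu)}$. The standard deviation is $\sigma=\left(\int_X(\phi-\bar t)^2\,d\nu\right)^{1/2}$, and the skewness is $\kappa=\frac{1}{\sigma^3}\int_X(\phi-\bar t)^3\,d\nu=\frac{\int_X\phi^3\,d\nu-3\bar t\sigma^2-\bar t^3}{\sigma^3}$. *)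

theory Defs
  imports "HOL-Probability.Probability"
begin

text \<open>No separation axiom is assumed of the topology, so a compact set need not be Borel; the
  supremum in the inner regularity condition therefore ranges over the compact Borel sets only.
  In a Hausdorff space this is the usual condition.\<close>

definition radon_measure :: "'a::topological_space measure \<Rightarrow> bool" where
  "radon_measure M \<longleftrightarrow>
     sets M = sets borel \<and>
     (\<forall>x. \<exists>U. open U \<and> x \<in> U \<and> emeasure M U < \<infinity>) \<and>
     (\<forall>A\<in>sets M. emeasure M A = (SUP K\<in>{K. compact K \<and> K \<in> sets M \<and> K \<subseteq> A}. emeasure M K))"

definition L4_norm :: "'a measure \<Rightarrow> ('a \<Rightarrow> real) \<Rightarrow> real" where
  "L4_norm M f = root 4 (LINT x|M. \<bar>f x\<bar> ^ 4)"

definition minimizes_L4_dist :: "'a measure \<Rightarrow> ('a \<Rightarrow> real) \<Rightarrow> real \<Rightarrow> bool" where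
  "minimizes_L4_dist M \<phi> a \<longleftrightarrow> (\<forall>c::real. L4_norm M (\<lambda>x. \<phi> x - a) \<le> L4_norm M (\<lambda>x. \<phi> x - c))"

definition four_average :: "'a measure \<Rightarrow> ('a \<Rightarrow> real) \<Rightarrow> real" where
  "four_average M \<phi> = (THE a. minimizes_L4_dist M \<phi> a)"

definition mean :: "'a measure \<Rightarrow> ('a \<Rightarrow> real) \<Rightarrow> real" where
  "mean M \<phi> = (LINT x|M. \<phi> x)"

definition std_deviation :: "'a measure \<Rightarrow> ('a \<Rightarrow> real) \<Rightarrow> real" where
  "std_deviation M \<phi> = sqrt (LINT x|M. (\<phi> x - mean M \<phi>) ^ 2)"

definition skewness :: "'a measure \<Rightarrow> ('a \<Rightarrow> real) \<Rightarrow> real" where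
  "skewness M \<phi> = 1 / std_deviation M \<phi> ^ 3 * (LINT x|M. (\<phi> x - mean M \<phi>) ^ 3)"

end

theory Submission
  imports Defs
begin

text \<open>
  After centring at the mean \<open>t\<close>, the moments of \<open>\<phi> - t\<close> of order one, two and three are
  \<open>0\<close>, \<open>\<sigma>\<^sup>2\<close> and \<open>\<kappa> \<sigma> ^ 3\<close>. Hence, writing \<open>x = t + s\<close>,
  the third moment about \<open>x\<close> is the depressed cubic \<open>\<kappa> \<sigma> ^ 3 - 3 \<sigma>\<^sup>2 s - s ^ 3\<close>, which is
  strictly decreasing in \<open>s\<close> and so has at most one zero. Rescaling by \<open>s = \<sigma> u\<close> turns it into
  \<open>u ^ 3 + 3 u = \<kappa>\<close>, which Cardano's formula solves (\<open>cardano_cubic\<close>).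

  The fourth moment about \<open>x\<close> is a quartic in \<open>s\<close> whose derivative is \<open>- 4\<close> times that cubic.
  Instead of arguing by convexity, the excess of the quartic over its value at the zero \<open>s\<^sub>0\<close> of
  the cubic is written as \<open>(s - s\<^sub>0)\<^sup>2\<close> times a positive factor (\<open>quartic_minus_critical_value\<close>),
  so the zero of the cubic is the only minimizer of the \<open>L\<^sup>4\<close> distance. Compactness bounds
  \<open>\<phi>\<close>, which makes all moments finite.
\<close>

text \<open>With \<open>p\<close> and \<open>q\<close> the two cube roots, \<open>p * q\<close> is the cube root of
  \<open>\<kappa>\<^sup>2 - (\<kappa>\<^sup>2 + 4) = - 4\<close>, and \<open>(p + q) ^ 3 = p ^ 3 + q ^ 3 + 3 * p * q * (p + q)\<close>.\<close>

lemma cardano_cubic: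
  fixes \<kappa> :: real
  defines "u \<equiv> (root 3 (\<kappa> + sqrt (\<kappa>\<^sup>2 + 4)) + root 3 (\<kappa> - sqrt (\<kappa>\<^sup>2 + 4))) / root 3 2"
  shows "u ^ 3 + 3 * u = \<kappa>"
proof -
  define p q c where "p = root 3 (\<kappa> + sqrt (\<kappa>\<^sup>2 + 4))"
    and "q = root 3 (\<kappa> - sqrt (\<kappa>\<^sup>2 + 4))" and "c = root 3 (2::real)"
  have p3: "p ^ 3 = \<kappa> + sqrt (\<kappa>\<^sup>2 + 4)" and q3: "q ^ 3 = \<kappa> - sqrt (\<kappa>\<^sup>2 + 4)" and c3: "c ^ 3 = 2"
    by (simp_all add: p_def q_def c_def odd_real_root_pow)
  have c0: "c \<noteq> 0" by (simp add: c_def)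
  have "(p * q) ^ 3 = (- (c\<^sup>2)) ^ 3"
  proof -
    have "(p * q) ^ 3 = \<kappa>\<^sup>2 - (sqrt (\<kappa>\<^sup>2 + 4))\<^sup>2"
      unfolding power_mult_distrib p3 q3 by (simp add: algebra_simps power2_eq_square)
    moreover have "(- (c\<^sup>2)) ^ 3 = - ((c ^ 3)\<^sup>2)"
      by (simp add: power2_eq_square power3_eq_cube)
    ultimately show ?thesis by (simp add: c3)
  qed
  then have pq: "p * q = - (c\<^sup>2)"
    using odd_real_root_unique[of 3 "p * q"] odd_real_root_unique[of 3 "- (c\<^sup>2)"] by force
  have cu: "c * u = p + q"
    using c0 by (simp add: u_def p_def q_def c_def)
  have "c ^ 3 * u ^ 3 = (p + q) ^ 3"
    using cu by (metis power_mult_distrib)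
  also have "\<dots> = p ^ 3 + q ^ 3 + 3 * (p * q) * (p + q)"
    by (simp add: algebra_simps power3_eq_cube)
  also have "\<dots> = 2 * \<kappa> - 3 * c\<^sup>2 * (c * u)"
    by (simp add: p3 q3 pq cu)
  also have "\<dots> = 2 * \<kappa> - 3 * c ^ 3 * u"
    by (simp add: power2_eq_square power3_eq_cube)
  finally show ?thesis by (simp add: c3)
qed

lemma strict_mono_cubic:
  fixes v :: real
  assumes "v > 0"
  shows "strict_mono (\<lambda>s::real. 3 * v * s + s ^ 3)"
proof (rule strict_monoI)
  fix r s :: real
  assume rs: "r < s"
  have "r ^ 3 < s ^ 3"
    using rs real_root_less_iff[of 3 "r ^ 3" "s ^ 3"] by (simp add: odd_real_root_power_cancel)
  with rs assms show "3 * v * r + r ^ 3 < 3 * v * s + s ^ 3"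
    by (intro add_strict_mono) auto
qed

text \<open>Substituting the critical equation for \<open>m\<close> makes \<open>s\<^sub>0\<close> a double root of the difference.\<close>

lemma quartic_minus_critical_value:
  fixes s s\<^sub>0 v m :: real
  assumes "3 * v * s\<^sub>0 + s\<^sub>0 ^ 3 = m"
  shows "(6 * v * s\<^sup>2 - 4 * m * s + s ^ 4) - (6 * v * s\<^sub>0\<^sup>2 - 4 * m * s\<^sub>0 + s\<^sub>0 ^ 4)
    = (s - s\<^sub>0)\<^sup>2 * (6 * v + (s + s\<^sub>0)\<^sup>2 + 2 * s\<^sub>0\<^sup>2)"
  unfolding assms[symmetric] by (simp add: algebra_simps power2_eq_square power3_eq_cube power4_eq_xxxx)

context prob_space
begin

lemma integrable_power_of_bounded:
  fixes f :: "'a \<Rightarrow> real"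
  assumes [measurable]: "f \<in> borel_measurable M" and "bounded (range f)"
  shows "integrable M (\<lambda>x. f x ^ n)"
proof -
  obtain B where B: "\<And>x. \<bar>f x\<bar> \<le> B"
    using assms(2) by (auto simp: bounded_iff)
  have "\<bar>f x ^ n\<bar> \<le> B ^ n" for x
    unfolding power_abs by (intro power_mono B) auto
  then show ?thesis
    by (intro integrable_const_bound[of _ "B ^ n"]) auto
qed

lemma third_moment_shift:
  fixes f :: "'a \<Rightarrow> real"
  assumes int: "\<And>n. integrable M (\<lambda>x. f x ^ n)" and "expectation f = 0"
  shows "expectation (\<lambda>x. (f x - s) ^ 3)
    = expectation (\<lambda>x. f x ^ 3) - (3 * expectation (\<lambda>x. (f x)\<^sup>2) * s + s ^ 3)"
proof -
  have "(f x - s) ^ 3 = f x ^ 3 - 3 * s * (f x)\<^sup>2 + 3 * s\<^sup>2 * f x - s ^ 3" for x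
    by (simp add: algebra_simps power2_eq_square power3_eq_cube)
  moreover have "integrable M f" using int[of 1] by simp
  ultimately show ?thesis
    using assms(2) by (simp add: int prob_space)
qed

lemma fourth_moment_shift:
  fixes f :: "'a \<Rightarrow> real"
  assumes int: "\<And>n. integrable M (\<lambda>x. f x ^ n)" and "expectation f = 0"
  shows "expectation (\<lambda>x. (f x - s) ^ 4) = expectation (\<lambda>x. f x ^ 4)
    + (6 * expectation (\<lambda>x. (f x)\<^sup>2) * s\<^sup>2 - 4 * expectation (\<lambda>x. f x ^ 3) * s + s ^ 4)"
proof -
  have "(f x - s) ^ 4 = f x ^ 4 - 4 * s * f x ^ 3 + 6 * s\<^sup>2 * (f x)\<^sup>2 - 4 * s ^ 3 * f x + s ^ 4" for x
    by (simp add: algebra_simps power2_eq_square power3_eq_cube power4_eq_xxxx)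
  moreover have "integrable M f" using int[of 1] by simp
  ultimately show ?thesis
    using assms(2) by (simp add: int prob_space)
qed

lemma std_deviation_pos:
  fixes f :: "'a \<Rightarrow> real"
  assumes "integrable M (\<lambda>x. (f x - mean M f)\<^sup>2)" and "\<not> (\<exists>c. AE x in M. f x = c)"
  shows "std_deviation M f > 0"
proof -
  have "expectation (\<lambda>x. (f x - mean M f)\<^sup>2) \<noteq> 0"
  proof
    assume "expectation (\<lambda>x. (f x - mean M f)\<^sup>2) = 0"
    then have "AE x in M. (f x - mean M f)\<^sup>2 = 0"
      using integral_nonneg_eq_0_iff_AE[OF assms(1)] by auto
    then have "AE x in M. f x = mean M f" by auto
    with assms(2) show False by blast
  qed
  moreover have "expectation (\<lambda>x. (f x - mean M f)\<^sup>2) \<ge> 0" by simp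
  ultimately show ?thesis
    unfolding std_deviation_def real_sqrt_gt_0_iff by linarith
qed

end

lemma minimizes_L4_dist_iff:
  "minimizes_L4_dist M \<phi> a \<longleftrightarrow>
    (\<forall>c. (LINT x|M. (\<phi> x - a) ^ 4) \<le> (LINT x|M. (\<phi> x - c) ^ 4))"
  by (simp add: minimizes_L4_dist_def L4_norm_def)

theorem lemma2p5:
  fixes \<nu> :: "'a::topological_space measure" and \<phi> :: "'a \<Rightarrow> real"
    and t \<sigma> \<kappa> :: real
  assumes "compact (UNIV :: 'a set)"
    and "prob_space \<nu>" and "radon_measure \<nu>"
    and "continuous_on UNIV \<phi>"
    and "\<not> (\<exists>c. AE x in \<nu>. \<phi> x = c)"
    and "t = mean \<nu> \<phi>"
    and "\<sigma> = std_deviation \<nu> \<phi>"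
    and "\<kappa> = skewness \<nu> \<phi>"
  shows "\<sigma> > 0
    \<and> (\<exists>!a. minimizes_L4_dist \<nu> \<phi> a)
    \<and> (\<forall>x::real. (LINT y|\<nu>. (\<phi> y - x) ^ 3) = 0 \<longleftrightarrow> x = four_average \<nu> \<phi>)
    \<and> four_average \<nu> \<phi> =
        \<sigma> / root 3 2 * (root 3 (\<kappa> + sqrt (\<kappa>\<^sup>2 + 4)) + root 3 (\<kappa> - sqrt (\<kappa>\<^sup>2 + 4))) + t"
proof -
  interpret prob_space \<nu> by fact
  define f where "f = (\<lambda>x. \<phi> x - t)"
  have "sets \<nu> = sets borel" using assms(3) by (simp add: radon_measure_def)
  then have meas: "\<phi> \<in> borel_measurable \<nu>"
    using borel_measurable_continuous_onI[OF assms(4)] measurable_cong_sets by blast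
  have bdd: "bounded (range \<phi>)"
    using compact_continuous_image[OF assms(4,1)] by (rule compact_imp_bounded)
  have int\<phi>: "integrable \<nu> \<phi>"
    using integrable_power_of_bounded[OF meas bdd, of 1] by simp
  have "bounded (range f)"
    using bounded_translation[OF bdd, of "- t"] by (simp add: f_def image_image)
  then have int: "integrable \<nu> (\<lambda>x. f x ^ n)" for n
    using meas by (intro integrable_power_of_bounded) (simp_all add: f_def)
  have f0: "expectation f = 0"
    using int\<phi> by (simp add: f_def prob_space assms(6) mean_def)
  have \<sigma>0: "\<sigma> > 0"
    using std_deviation_pos[of \<phi>] int[of 2] assms(5) by (simp add: assms(6,7) f_def)

  define m where "m = expectation (\<lambda>x. f x ^ 3)"
  have var: "expectation (\<lambda>x. (f x)\<^sup>2) = \<sigma>\<^sup>2"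
    by (simp add: f_def assms(6,7) std_deviation_def)
  have m: "m = \<kappa> * \<sigma> ^ 3"
    using \<sigma>0 by (simp add: m_def f_def assms(6-8) skewness_def)

  define u where "u = (root 3 (\<kappa> + sqrt (\<kappa>\<^sup>2 + 4)) + root 3 (\<kappa> - sqrt (\<kappa>\<^sup>2 + 4))) / root 3 2"
  define s\<^sub>0 where "s\<^sub>0 = \<sigma> * u"
  have crit: "3 * \<sigma>\<^sup>2 * s\<^sub>0 + s\<^sub>0 ^ 3 = m"
  proof -
    have "3 * \<sigma>\<^sup>2 * s\<^sub>0 + s\<^sub>0 ^ 3 = \<sigma> ^ 3 * (u ^ 3 + 3 * u)"
      by (simp add: s\<^sub>0_def algebra_simps power2_eq_square power3_eq_cube)
    then show ?thesis using cardano_cubic[of \<kappa>] by (simp add: m u_def)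
  qed

  have shift: "\<phi> y - x = f y - (x - t)" for x y by (simp add: f_def)
  have zero_iff: "(LINT y|\<nu>. (\<phi> y - x) ^ 3) = 0 \<longleftrightarrow> x = s\<^sub>0 + t" for x
  proof -
    have "(LINT y|\<nu>. (\<phi> y - x) ^ 3) = m - (3 * \<sigma>\<^sup>2 * (x - t) + (x - t) ^ 3)"
      unfolding shift by (simp only: third_moment_shift[OF int f0] var m_def)
    then have "(LINT y|\<nu>. (\<phi> y - x) ^ 3) = 0 \<longleftrightarrow>
        3 * \<sigma>\<^sup>2 * (x - t) + (x - t) ^ 3 = 3 * \<sigma>\<^sup>2 * s\<^sub>0 + s\<^sub>0 ^ 3"
      using crit by auto
    also have "\<dots> \<longleftrightarrow> x - t = s\<^sub>0"
      using strict_mono_eq[OF strict_mono_cubic[of "\<sigma>\<^sup>2"]] \<sigma>0 by simp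
    finally show ?thesis by auto
  qed

  have excess: "(LINT y|\<nu>. (\<phi> y - x) ^ 4) - (LINT y|\<nu>. (\<phi> y - (s\<^sub>0 + t)) ^ 4)
      = (x - (s\<^sub>0 + t))\<^sup>2 * (6 * \<sigma>\<^sup>2 + (x - t + s\<^sub>0)\<^sup>2 + 2 * s\<^sub>0\<^sup>2)" for x
    unfolding shift fourth_moment_shift[OF int f0] var m_def[symmetric]
    using quartic_minus_critical_value[OF crit, of "x - t"] by (simp add: algebra_simps)
  have factor_pos: "6 * \<sigma>\<^sup>2 + (x - t + s\<^sub>0)\<^sup>2 + 2 * s\<^sub>0\<^sup>2 > 0" for x
    using \<sigma>0 by (intro add_pos_nonneg) auto
  have min_iff: "minimizes_L4_dist \<nu> \<phi> a \<longleftrightarrow> a = s\<^sub>0 + t" for a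
  proof
    assume "minimizes_L4_dist \<nu> \<phi> a"
    then have "(a - (s\<^sub>0 + t))\<^sup>2 * (6 * \<sigma>\<^sup>2 + (a - t + s\<^sub>0)\<^sup>2 + 2 * s\<^sub>0\<^sup>2) \<le> 0"
      unfolding excess[symmetric] by (simp add: minimizes_L4_dist_iff)
    then have "(a - (s\<^sub>0 + t))\<^sup>2 \<le> 0"
      using factor_pos[of a] by (simp add: mult_le_0_iff)
    then show "a = s\<^sub>0 + t" by simp
  next
    assume a: "a = s\<^sub>0 + t"
    have "0 \<le> (LINT y|\<nu>. (\<phi> y - c) ^ 4) - (LINT y|\<nu>. (\<phi> y - (s\<^sub>0 + t)) ^ 4)" for c
      unfolding excess using factor_pos[of c] by (intro mult_nonneg_nonneg) auto
    then show "minimizes_L4_dist \<nu> \<phi> a"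
      by (simp add: minimizes_L4_dist_iff a)
  qed
  have avg: "four_average \<nu> \<phi> = s\<^sub>0 + t"
    by (simp add: four_average_def min_iff)
  then have "four_average \<nu> \<phi> =
      \<sigma> / root 3 2 * (root 3 (\<kappa> + sqrt (\<kappa>\<^sup>2 + 4)) + root 3 (\<kappa> - sqrt (\<kappa>\<^sup>2 + 4))) + t"
    by (simp add: s\<^sub>0_def u_def)
  with \<sigma>0 show ?thesis by (simp add: min_iff zero_iff avg)
qed

end
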